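(* Let $K$ be a field containing $\mathbb{Q}$ and let $r\in\widetilde{K}$. Then there exist an integer $m\geq 1$ and a polynomial $T(x,x_1,\dots,x_m)\in\mathbb{Q}[x,x_1,\dots,x_m]$ such that for all $x\in K$: $x=r$ if and only if there exist $x_1,\dots,x_m\in K$ with $T(x,x_1,\dots,x_m)=0$.
   Context: Let $K$ be a field. For $r\in K$, a finite set $A(r)$ with $\{r\}\subseteq A(r)\subseteq K$ is called adequate for $r$ if every mapping $f:A(r)\to K$ satisfying (1) if $1\in A(r)$ then $f(1)=1$; (2) if $a,b\in A(r)$ and $a+b\in A(r)$ then $f(a+b)=f(a)+f(b)$; (3) if $a,b\in A(r)$ and $a\cdot b\in A(r)$ then $f(a\cdot b)=f(a)\cdot f(b)$, also satisfies $f(r)=r$. $\widetilde{K}$ denotes the set of all $r\in K$ for which some finite set adequate for $r$ exists. *)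

theory Defs
  imports Main "HOL.Rat"
begin

definition adequate_for :: "'a::field \<Rightarrow> 'a set \<Rightarrow> bool" where
  "adequate_for r A \<longleftrightarrow> finite A \<and> r \<in> A \<and>
     (\<forall>f :: 'a \<Rightarrow> 'a.
        (1 \<in> A \<longrightarrow> f 1 = 1) \<longrightarrow>
        (\<forall>a\<in>A. \<forall>b\<in>A. a + b \<in> A \<longrightarrow> f (a + b) = f a + f b) \<longrightarrow>
        (\<forall>a\<in>A. \<forall>b\<in>A. a * b \<in> A \<longrightarrow> f (a * b) = f a * f b) \<longrightarrow>
        f r = r)"

definition Ktilde :: "'a::field set" where
  "Ktilde = {r. \<exists>A. adequate_for r A}"

text \<open>Multivariate polynomials with rational coefficients, as formal expressions
  in the variables indexed by natural numbers (variable 0 is x, variable i is x_i).\<close>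
datatype qpoly = QConst rat | QVar nat | QAdd qpoly qpoly | QMul qpoly qpoly

fun qeval :: "(nat \<Rightarrow> 'a::field_char_0) \<Rightarrow> qpoly \<Rightarrow> 'a" where
  "qeval v (QConst c) = of_rat c"
| "qeval v (QVar i) = v i"
| "qeval v (QAdd p q) = qeval v p + qeval v q"
| "qeval v (QMul p q) = qeval v p * qeval v q"

fun qvars :: "qpoly \<Rightarrow> nat set" where
  "qvars (QConst c) = {}"
| "qvars (QVar i) = {i}"
| "qvars (QAdd p q) = qvars p \<union> qvars q"
| "qvars (QMul p q) = qvars p \<union> qvars q"

end

theory Submission
  imports Defs "HOL-Algebra.Algebraic_Closure_Type"
begin

text \<open>
  The conditions on a map from an adequate set to K form a finite system of polynomial equations
  over the rationals whose solutions in K all have the same r-coordinate.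

  If some nonconstant rational polynomial has no root in K, its homogenization is a binary form
  that vanishes only at the origin, and nesting it merges the system into one equation.

  Otherwise r is rational, so that x - r will do. Indeed the ring generated by the adequate
  set has a homomorphism to the algebraic numbers (Nullstellensatz). If the image of r is
  irrational, composing with a conjugation that moves it gives a second homomorphism with a
  different value at r. Finitely many algebraic numbers lie in some \<rat>(\<theta>), which
  embeds into K because the minimal polynomial of \<theta> has a root there. This yields two
  solutions in K with different r-coordinates. If the image of r is rational, the embedding
  sends it back to itself, so r equals it.
\<close>

section \<open>Subrings and their polynomials\<close>

locale unital_subring =
  fixes B :: "'a::comm_ring_1 set"
  assumes one_mem [simp]: "1 \<in> B"
    and diff_mem [simp]: "x \<in> B \<Longrightarrow> y \<in> B \<Longrightarrow> x - y \<in> B"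
    and mult_mem [simp]: "x \<in> B \<Longrightarrow> y \<in> B \<Longrightarrow> x * y \<in> B"
begin

lemma zero_mem [simp]: "0 \<in> B"
  using diff_mem[of 1 1] by simp

lemma uminus_mem [simp]: "x \<in> B \<Longrightarrow> - x \<in> B"
  using diff_mem[of 0 x] by simp

lemma add_mem [simp]: "x \<in> B \<Longrightarrow> y \<in> B \<Longrightarrow> x + y \<in> B"
  using diff_mem[of x "- y"] by simp

lemma power_mem [simp]: "x \<in> B \<Longrightarrow> x ^ n \<in> B"
  by (induction n) auto

lemma of_nat_mem [simp]: "of_nat n \<in> B"
  by (induction n) auto

lemma sum_mem: "(\<And>i. i \<in> I \<Longrightarrow> f i \<in> B) \<Longrightarrow> sum f I \<in> B"
  by (induction I rule: infinite_finite_induct) auto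

end

locale unital_subfield = unital_subring B for B :: "'a::field set" +
  assumes inverse_mem [simp]: "x \<in> B \<Longrightarrow> inverse x \<in> B"

lemma unital_subfield_Rats: "unital_subfield \<rat>"
  by unfold_locales auto

definition poly_over :: "'a::comm_ring_1 set \<Rightarrow> 'a poly set" where
  "poly_over B = {p. \<forall>i. coeff p i \<in> B}"

lemma coeff_mem: "p \<in> poly_over B \<Longrightarrow> coeff p i \<in> B"
  by (simp add: poly_over_def)

lemma poly_over_mono: "B \<subseteq> C \<Longrightarrow> poly_over B \<subseteq> poly_over C"
  by (auto simp: poly_over_def)

context unital_subring
begin

lemma unital_subring_poly_over: "unital_subring (poly_over B)"
  by unfold_locales (auto simp: poly_over_def coeff_mult coeff_1 intro!: sum_mem)

lemma pCons_mem_poly_over_iff [simp]: "pCons c p \<in> poly_over B \<longleftrightarrow> c \<in> B \<and> p \<in> poly_over B"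
  by (auto simp: poly_over_def coeff_pCons split: nat.splits)

lemma zero_mem_poly_over [simp]: "0 \<in> poly_over B"
  by (simp add: poly_over_def)

lemma monom_mem_poly_over [simp]: "c \<in> B \<Longrightarrow> monom c n \<in> poly_over B"
  by (simp add: poly_over_def)

lemma smult_mem_poly_over [simp]: "c \<in> B \<Longrightarrow> p \<in> poly_over B \<Longrightarrow> smult c p \<in> poly_over B"
  by (simp add: poly_over_def)

lemma poly_mem: "p \<in> poly_over B \<Longrightarrow> a \<in> B \<Longrightarrow> poly p a \<in> B"
  by (induction p) auto

lemma pcompose_mem_poly_over:
  assumes "p \<in> poly_over B" "q \<in> poly_over B"
  shows "p \<circ>\<^sub>p q \<in> poly_over B"
proof -
  interpret poly_over: unital_subring "poly_over B" by (rule unital_subring_poly_over)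
  show ?thesis using assms by (induction p) (auto simp: pcompose_pCons)
qed

lemma pseudo_divmod_main_mem_poly_over:
  assumes "pseudo_divmod_main lc q r d dr n = (q', r')"
    and "lc \<in> B" "q \<in> poly_over B" "r \<in> poly_over B" "d \<in> poly_over B"
  shows "q' \<in> poly_over B \<and> r' \<in> poly_over B"
proof -
  interpret poly_over: unital_subring "poly_over B" by (rule unital_subring_poly_over)
  show ?thesis
    using assms
    by (induction lc q r d dr n rule: pseudo_divmod_main.induct) (auto simp: Let_def coeff_mem)
qed

lemma poly_over_pseudo_division:
  assumes "f \<in> poly_over B" "g \<in> poly_over B" "g \<noteq> 0"
  obtains n q s where "q \<in> poly_over B" "s \<in> poly_over B"
    "smult (lead_coeff g ^ n) f = q * g + s" "s = 0 \<or> degree s < degree g"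
proof -
  obtain q s where qs: "pseudo_divmod f g = (q, s)" by fastforce
  then have "q \<in> poly_over B \<and> s \<in> poly_over B"
    using assms coeff_mem[OF assms(2)]
    by (intro pseudo_divmod_main_mem_poly_over[of "lead_coeff g" 0 f g])
      (auto simp: pseudo_divmod_def)
  with pseudo_divmod[OF \<open>g \<noteq> 0\<close> qs] that show ?thesis by (metis mult.commute)
qed

lemma least_degree_pseudo_divides:
  assumes I: "I \<subseteq> poly_over B" "\<And>f g. f \<in> I \<Longrightarrow> g \<in> I \<Longrightarrow> f - g \<in> I"
      "\<And>f q. f \<in> I \<Longrightarrow> q \<in> poly_over B \<Longrightarrow> q * f \<in> I"
    and d: "d \<in> I" "d \<noteq> 0" "\<And>g. g \<in> I \<Longrightarrow> g \<noteq> 0 \<Longrightarrow> degree d \<le> degree g"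
    and f: "f \<in> I"
  obtains n q where "q \<in> poly_over B" "smult (lead_coeff d ^ n) f = q * d"
proof -
  obtain n q s where division: "q \<in> poly_over B" "smult (lead_coeff d ^ n) f = q * d + s"
    "s = 0 \<or> degree s < degree d"
    using poly_over_pseudo_division d(1,2) f I(1) by (metis subsetD)
  have "[:lead_coeff d ^ n:] * f - q * d \<in> I"
    using I(1) d(1) f division(1) by (intro I(2,3)) (auto simp: coeff_mem)
  moreover have "[:lead_coeff d ^ n:] * f - q * d = s"
    using division(2) by simp
  ultimately have "s = 0" using division(3) d(3) by (metis not_le)
  with division that show ?thesis by simp
qed

lemma poly_ideal_pseudo_principal:
  assumes I: "I \<subseteq> poly_over B" "\<And>f g. f \<in> I \<Longrightarrow> g \<in> I \<Longrightarrow> f - g \<in> I"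
      "\<And>f q. f \<in> I \<Longrightarrow> q \<in> poly_over B \<Longrightarrow> q * f \<in> I"
    and "f \<in> I" "f \<noteq> 0"
  obtains d where "d \<in> I" "d \<noteq> 0"
    "\<And>g. g \<in> I \<Longrightarrow> \<exists>n. \<exists>q\<in>poly_over B. smult (lead_coeff d ^ n) g = q * d"
proof -
  obtain d where d: "d \<in> I" "d \<noteq> 0" "\<And>g. g \<in> I \<Longrightarrow> g \<noteq> 0 \<Longrightarrow> degree d \<le> degree g"
    using ex_has_least_nat[of "\<lambda>f. f \<in> I \<and> f \<noteq> 0" f degree] assms(4,5) by blast
  have "\<exists>n. \<exists>q\<in>poly_over B. smult (lead_coeff d ^ n) g = q * d" if "g \<in> I" for g
    by (rule least_degree_pseudo_divides[OF I d that]) auto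
  with d(1,2) that show ?thesis by blast
qed

end

definition adjoin :: "'a::comm_ring_1 set \<Rightarrow> 'a \<Rightarrow> 'a set" where
  "adjoin B a = (\<lambda>p. poly p a) ` poly_over B"

lemma poly_mem_adjoin: "p \<in> poly_over B \<Longrightarrow> poly p a \<in> adjoin B a"
  by (simp add: adjoin_def)

lemma adjoinE:
  assumes "x \<in> adjoin B a"
  obtains p where "p \<in> poly_over B" "x = poly p a"
  using assms by (auto simp: adjoin_def)

lemma (in unital_subring) unital_subring_adjoin: "unital_subring (adjoin B a)"
proof -
  interpret poly_over: unital_subring "poly_over B" by (rule unital_subring_poly_over)
  show ?thesis
  proof
    show "1 \<in> adjoin B a" using poly_mem_adjoin[OF poly_over.one_mem, of a] by simp
    fix x y assume "x \<in> adjoin B a" "y \<in> adjoin B a"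
    then show "x - y \<in> adjoin B a" "x * y \<in> adjoin B a"
      by (auto elim!: adjoinE intro!: poly_mem_adjoin simp flip: poly_diff poly_mult)
  qed
qed

lemma (in unital_subring) subset_adjoin: "B \<subseteq> adjoin B a"
  using poly_mem_adjoin[of "[:_:]" B a] by auto

lemma (in unital_subring) mem_adjoin: "a \<in> adjoin B a"
  using poly_mem_adjoin[of "[:0, 1:]" B a] by simp

lemma (in unital_subring) adjoin_subset: "C \<subseteq> B \<Longrightarrow> a \<in> B \<Longrightarrow> adjoin C a \<subseteq> B"
  using poly_over_mono[of C B] poly_mem by (auto elim!: adjoinE)

section \<open>Minimal polynomials\<close>

definition algebraic_over :: "'a::comm_ring_1 set \<Rightarrow> 'a \<Rightarrow> bool" where
  "algebraic_over B a \<longleftrightarrow> (\<exists>p\<in>poly_over B. p \<noteq> 0 \<and> poly p a = 0)"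

definition min_poly_over :: "'a::comm_ring_1 set \<Rightarrow> 'a \<Rightarrow> 'a poly \<Rightarrow> bool" where
  "min_poly_over B a P \<longleftrightarrow>
     is_arg_min degree (\<lambda>p. p \<in> poly_over B \<and> p \<noteq> 0 \<and> poly p a = 0) P"

lemma
  assumes "min_poly_over B a P"
  shows min_poly_over_mem: "P \<in> poly_over B"
    and min_poly_over_nonzero: "P \<noteq> 0"
    and min_poly_over_root: "poly P a = 0"
    and min_poly_over_degree_le:
      "p \<in> poly_over B \<Longrightarrow> p \<noteq> 0 \<Longrightarrow> poly p a = 0 \<Longrightarrow> degree P \<le> degree p"
  using assms by (auto simp: min_poly_over_def is_arg_min_linorder)

lemma algebraic_over_mono: "algebraic_over B a \<Longrightarrow> B \<subseteq> C \<Longrightarrow> algebraic_over C a"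
  using poly_over_mono unfolding algebraic_over_def by blast

lemma algebraic_over_imp_min_poly:
  assumes "algebraic_over B a"
  obtains P where "min_poly_over B a P"
proof -
  let ?annihilates = "\<lambda>p. p \<in> poly_over B \<and> p \<noteq> 0 \<and> poly p a = 0"
  obtain p where "?annihilates p" using assms by (auto simp: algebraic_over_def)
  then have "min_poly_over B a (arg_min degree ?annihilates)"
    unfolding min_poly_over_def by (rule is_arg_min_arg_min_nat)
  then show ?thesis by (rule that)
qed

lemma min_poly_over_degree_pos:
  assumes "min_poly_over B a P"
  shows "degree P > 0"
proof (rule ccontr)
  assume "\<not> degree P > 0"
  then obtain c where "P = [:c:]" by (metis degree_eq_zeroE gr0I)
  then show False using min_poly_over_nonzero[OF assms] min_poly_over_root[OF assms] by simp
qed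

lemma (in unital_subring) min_poly_over_pseudo_divides:
  assumes P: "min_poly_over B a P" and g: "g \<in> poly_over B" "poly g a = 0"
  obtains n q where "q \<in> poly_over B" "smult (lead_coeff P ^ n) g = q * P"
proof -
  interpret poly_over: unital_subring "poly_over B" by (rule unital_subring_poly_over)
  show ?thesis
  proof (rule least_degree_pseudo_divides)
    show "{p \<in> poly_over B. poly p a = 0} \<subseteq> poly_over B" by blast
    show "P \<in> {p \<in> poly_over B. poly p a = 0}" "P \<noteq> 0"
      using min_poly_over_mem[OF P] min_poly_over_root[OF P] min_poly_over_nonzero[OF P] by auto
    show "g \<in> {p \<in> poly_over B. poly p a = 0}" using g by simp
  qed (use min_poly_over_degree_le[OF P] that in auto)
qed

lemma (in unital_subfield) min_poly_over_dvd:
  assumes P: "min_poly_over B a P" and g: "g \<in> poly_over B" "poly g a = 0"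
  shows "P dvd g"
proof -
  obtain n q where "smult (lead_coeff P ^ n) g = q * P"
    using min_poly_over_pseudo_divides[OF P g] by metis
  then have "P dvd smult (lead_coeff P ^ n) g" by simp
  then show ?thesis using min_poly_over_nonzero[OF P] by (simp add: dvd_smult_iff)
qed

lemma min_poly_over_nonvanishing_divisor_degree:
  fixes a :: "'a::idom"
  assumes P: "min_poly_over B a P" and factorization: "smult c P = q * d" "c \<noteq> 0"
    and "q \<in> poly_over B" "poly d a \<noteq> 0"
  shows "degree d = 0"
proof -
  have "q \<noteq> 0" "d \<noteq> 0" using factorization min_poly_over_nonzero[OF P] by auto
  have "poly q a * poly d a = 0"
    using arg_cong[OF factorization(1), of "\<lambda>f. poly f a"] min_poly_over_root[OF P] by simp
  then have "degree P \<le> degree q"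
    using \<open>q \<in> poly_over B\<close> \<open>q \<noteq> 0\<close> \<open>poly d a \<noteq> 0\<close> by (intro min_poly_over_degree_le[OF P]) auto
  moreover have "degree P = degree q + degree d"
    using arg_cong[OF factorization(1), of degree] \<open>c \<noteq> 0\<close> \<open>q \<noteq> 0\<close> \<open>d \<noteq> 0\<close>
    by (simp add: degree_mult_eq)
  ultimately show ?thesis by simp
qed

lemma algebraic_adjoin_multiple_in_base:
  fixes a :: "'a::idom"
  assumes B: "unital_subring B" and a: "algebraic_over B a" and u: "u \<in> adjoin B a" "u \<noteq> 0"
  obtains s where "s \<in> adjoin B a" "s * u \<in> B" "s * u \<noteq> 0"
proof -
  interpret unital_subring B by (rule B)
  interpret poly_over: unital_subring "poly_over B" by (rule unital_subring_poly_over)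
  interpret adjoin: unital_subring "adjoin B a" by (rule unital_subring_adjoin)
  obtain P where P: "min_poly_over B a P" using algebraic_over_imp_min_poly[OF a] .
  obtain p where p: "p \<in> poly_over B" "u = poly p a" using u(1) by (rule adjoinE)
  \<comment> \<open>A generator of \<open>I\<close> pseudo-divides \<open>p\<close>, so it does not vanish at \<open>a\<close>. As it also
    pseudo-divides \<open>P\<close>, minimality of \<open>P\<close> makes it constant.\<close>
  define I where "I = {f \<in> poly_over B. \<exists>s\<in>adjoin B a. poly f a = s * u}"
  have "P \<in> I"
    using min_poly_over_mem[OF P] min_poly_over_root[OF P]
    by (auto simp: I_def intro!: bexI[of _ 0])
  have "p \<in> I" using p by (auto simp: I_def intro!: bexI[of _ 1])
  obtain d where d: "d \<in> I" "d \<noteq> 0"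
    "\<And>f. f \<in> I \<Longrightarrow> \<exists>n. \<exists>q\<in>poly_over B. smult (lead_coeff d ^ n) f = q * d"
  proof (rule poly_ideal_pseudo_principal[OF _ _ _ \<open>P \<in> I\<close> min_poly_over_nonzero[OF P]])
    show "f - g \<in> I" if "f \<in> I" "g \<in> I" for f g
      using that by (auto simp: I_def simp flip: left_diff_distrib)
    show "q * f \<in> I" if "f \<in> I" "q \<in> poly_over B" for f q
      using that poly_mem_adjoin[of q B a] by (auto simp: I_def simp flip: mult.assoc)
  qed (auto simp: I_def)
  obtain m p' where "smult (lead_coeff d ^ m) p = p' * d" using d(3)[OF \<open>p \<in> I\<close>] by blast
  then have "lead_coeff d ^ m * u = poly p' a * poly d a"
    using p(2) by (metis poly_mult poly_smult)
  then have "poly d a \<noteq> 0" using u(2) d(2) by auto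
  obtain n q where "q \<in> poly_over B" "smult (lead_coeff d ^ n) P = q * d"
    using d(3)[OF \<open>P \<in> I\<close>] by blast
  then have "degree d = 0"
    using d(2) \<open>poly d a \<noteq> 0\<close>
    by (intro min_poly_over_nonvanishing_divisor_degree[OF P, of "lead_coeff d ^ n" q]) auto
  then obtain c where "d = [:c:]" by (rule degree_eq_zeroE)
  with d(1,2) that show ?thesis by (auto simp: I_def)
qed

section \<open>Homomorphisms on subrings\<close>

locale ring_hom_on = unital_subring B for B :: "'a::comm_ring_1 set" +
  fixes \<phi> :: "'a \<Rightarrow> 'b::comm_ring_1"
  assumes hom_one [simp]: "\<phi> 1 = 1"
    and hom_add: "x \<in> B \<Longrightarrow> y \<in> B \<Longrightarrow> \<phi> (x + y) = \<phi> x + \<phi> y"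
    and hom_mult: "x \<in> B \<Longrightarrow> y \<in> B \<Longrightarrow> \<phi> (x * y) = \<phi> x * \<phi> y"
begin

lemma hom_zero [simp]: "\<phi> 0 = 0"
  using hom_add[of 0 0] by simp

lemma hom_diff: "x \<in> B \<Longrightarrow> y \<in> B \<Longrightarrow> \<phi> (x - y) = \<phi> x - \<phi> y"
  using hom_add[of "x - y" y] by (simp add: eq_diff_eq)

lemma hom_sum: "(\<And>i. i \<in> I \<Longrightarrow> f i \<in> B) \<Longrightarrow> \<phi> (sum f I) = (\<Sum>i\<in>I. \<phi> (f i))"
  by (induction I rule: infinite_finite_induct) (auto simp: hom_add sum_mem)

lemma hom_power: "x \<in> B \<Longrightarrow> \<phi> (x ^ n) = \<phi> x ^ n"
  by (induction n) (auto simp: hom_mult)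

lemma ring_hom_on_map_poly: "ring_hom_on (poly_over B) (map_poly \<phi>)"
proof -
  interpret poly_over: unital_subring "poly_over B" by (rule unital_subring_poly_over)
  show ?thesis
    by unfold_locales
      (auto intro!: poly_eqI sum.cong
        simp: coeff_map_poly coeff_mem hom_add coeff_mult hom_sum hom_mult)
qed

lemma hom_poly: "p \<in> poly_over B \<Longrightarrow> a \<in> B \<Longrightarrow> \<phi> (poly p a) = poly (map_poly \<phi> p) (\<phi> a)"
  by (induction p) (auto simp: map_poly_pCons hom_add hom_mult poly_mem)

lemma extends_to_adjoin:
  assumes relations: "\<And>p. p \<in> poly_over B \<Longrightarrow> poly p a = 0 \<Longrightarrow> poly (map_poly \<phi> p) c = 0"
  obtains \<psi> where "ring_hom_on (adjoin B a) \<psi>" "\<And>x. x \<in> B \<Longrightarrow> \<psi> x = \<phi> x" "\<psi> a = c"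
proof -
  interpret poly_over: ring_hom_on "poly_over B" "map_poly \<phi>" by (rule ring_hom_on_map_poly)
  interpret adjoin: unital_subring "adjoin B a" by (rule unital_subring_adjoin)
  define \<psi> where "\<psi> x = poly (map_poly \<phi> (SOME p. p \<in> poly_over B \<and> poly p a = x)) c" for x
  have \<psi>_poly: "\<psi> (poly p a) = poly (map_poly \<phi> p) c" if p: "p \<in> poly_over B" for p
  proof -
    define p' where "p' = (SOME p'. p' \<in> poly_over B \<and> poly p' a = poly p a)"
    have p': "p' \<in> poly_over B" "poly p' a = poly p a"
      using someI[of "\<lambda>p'. p' \<in> poly_over B \<and> poly p' a = poly p a" p] p by (auto simp: p'_def)
    then have "poly (map_poly \<phi> (p' - p)) c = 0" using p by (intro relations) auto
    then show ?thesis using p p' by (simp add: \<psi>_def p'_def poly_over.hom_diff)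
  qed
  show ?thesis
  proof (rule that)
    show "ring_hom_on (adjoin B a) \<psi>"
    proof
      show "\<psi> 1 = 1" using \<psi>_poly[of 1] by simp
      fix x y assume "x \<in> adjoin B a" "y \<in> adjoin B a"
      then obtain p q where pq: "p \<in> poly_over B" "q \<in> poly_over B" "x = poly p a" "y = poly q a"
        by (auto elim!: adjoinE)
      show "\<psi> (x + y) = \<psi> x + \<psi> y"
        using pq \<psi>_poly[of "p + q"] by (simp add: \<psi>_poly poly_over.hom_add)
      show "\<psi> (x * y) = \<psi> x * \<psi> y"
        using pq \<psi>_poly[of "p * q"] by (simp add: \<psi>_poly poly_over.hom_mult)
    qed
    show "\<psi> x = \<phi> x" if "x \<in> B" for x
      using \<psi>_poly[of "[:x:]"] that by (simp add: map_poly_pCons)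
    show "\<psi> a = c" using \<psi>_poly[of "[:0, 1:]"] by (simp add: map_poly_pCons)
  qed
qed

end

lemma ring_hom_on_comp:
  assumes \<phi>: "ring_hom_on B \<phi>" and \<psi>: "ring_hom_on C \<psi>"
  shows "ring_hom_on (B \<inter> \<phi> -` C) (\<psi> \<circ> \<phi>)"
proof -
  interpret \<phi>: ring_hom_on B \<phi> by (rule \<phi>)
  interpret \<psi>: ring_hom_on C \<psi> by (rule \<psi>)
  show ?thesis
    by unfold_locales
      (auto simp: \<phi>.hom_diff \<phi>.hom_add \<phi>.hom_mult \<psi>.hom_add \<psi>.hom_mult)
qed

lemma ring_hom_on_subfield_nonzero:
  assumes F: "unital_subfield F" and \<phi>: "ring_hom_on F \<phi>" and x: "x \<in> F" "x \<noteq> 0"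
  shows "\<phi> x \<noteq> 0"
proof
  interpret unital_subfield F by (rule F)
  interpret ring_hom_on F \<phi> by (rule \<phi>)
  assume "\<phi> x = 0"
  moreover have "\<phi> (x * inverse x) = \<phi> x * \<phi> (inverse x)" using x(1) by (intro hom_mult) auto
  ultimately show False using x(2) by simp
qed

lemma ring_hom_on_subfield_inj_on:
  assumes F: "unital_subfield F" and \<phi>: "ring_hom_on F \<phi>"
  shows "inj_on \<phi> F"
proof (rule inj_onI)
  interpret ring_hom_on F \<phi> by (rule \<phi>)
  fix x y assume "x \<in> F" "y \<in> F" "\<phi> x = \<phi> y"
  then show "x = y"
    using ring_hom_on_subfield_nonzero[OF F \<phi>, of "x - y"] by (auto simp: hom_diff)
qed

lemma hom_extends_to_root:
  fixes \<phi> :: "'a::idom \<Rightarrow> 'b::idom"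
  assumes \<phi>: "ring_hom_on B \<phi>" and P: "min_poly_over B a P" "\<phi> (lead_coeff P) \<noteq> 0"
    and c: "poly (map_poly \<phi> P) c = 0"
  obtains \<psi> where "ring_hom_on (adjoin B a) \<psi>" "\<And>x. x \<in> B \<Longrightarrow> \<psi> x = \<phi> x" "\<psi> a = c"
proof -
  interpret ring_hom_on B \<phi> by (rule \<phi>)
  interpret poly_over: ring_hom_on "poly_over B" "map_poly \<phi>" by (rule ring_hom_on_map_poly)
  have lead: "lead_coeff P \<in> B" using min_poly_over_mem[OF P(1)] by (rule coeff_mem)
  show ?thesis
  proof (rule extends_to_adjoin)
    fix p assume p: "p \<in> poly_over B" "poly p a = 0"
    obtain n q where q: "q \<in> poly_over B" "smult (lead_coeff P ^ n) p = q * P"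
      using min_poly_over_pseudo_divides[OF P(1) p] .
    have "smult (\<phi> (lead_coeff P) ^ n) (map_poly \<phi> p) = map_poly \<phi> ([:lead_coeff P ^ n:] * p)"
      using p(1) lead by (subst poly_over.hom_mult) (auto simp: map_poly_pCons hom_power)
    also have "\<dots> = map_poly \<phi> (q * P)" using q(2) by simp
    also have "\<dots> = map_poly \<phi> q * map_poly \<phi> P"
      using q(1) min_poly_over_mem[OF P(1)] by (rule poly_over.hom_mult)
    finally have "\<phi> (lead_coeff P) ^ n * poly (map_poly \<phi> p) c = 0"
      using c by (metis poly_smult poly_mult mult_zero_right)
    then show "poly (map_poly \<phi> p) c = 0" using P(2) by simp
  qed (use that in blast)
qed

lemma hom_to_alg_closed_extends:
  fixes \<phi> :: "'a::idom \<Rightarrow> 'b::alg_closed_field"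
  assumes \<phi>: "ring_hom_on B \<phi>" and P: "min_poly_over B a P" "\<phi> (lead_coeff P) \<noteq> 0"
  obtains \<psi> where "ring_hom_on (adjoin B a) \<psi>" "\<And>x. x \<in> B \<Longrightarrow> \<psi> x = \<phi> x"
proof -
  interpret ring_hom_on B \<phi> by (rule \<phi>)
  have "coeff (map_poly \<phi> P) (degree P) \<noteq> 0" using P(2) by (simp add: coeff_map_poly)
  then have "degree (map_poly \<phi> P) > 0"
    using le_degree min_poly_over_degree_pos[OF P(1)] order_less_le_trans by blast
  then obtain c where "poly (map_poly \<phi> P) c = 0" using alg_closed_imp_poly_has_root by blast
  with hom_extends_to_root[OF \<phi> P] that show ?thesis by blast
qed

section \<open>Homomorphisms from finitely generated rings to algebraically closed fields\<close>

definition separated_by_homs :: "'a::comm_ring_1 set \<Rightarrow> 'b::comm_ring_1 itself \<Rightarrow> bool" where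
  "separated_by_homs B _ \<longleftrightarrow>
     (\<forall>u\<in>B. u \<noteq> 0 \<longrightarrow> (\<exists>\<phi>::'a \<Rightarrow> 'b. ring_hom_on B \<phi> \<and> \<phi> u \<noteq> 0))"

lemma separated_by_homsE:
  fixes B :: "'a::comm_ring_1 set"
  assumes "separated_by_homs B TYPE('b::comm_ring_1)" "u \<in> B" "u \<noteq> 0"
  obtains \<phi> :: "'a \<Rightarrow> 'b::comm_ring_1" where "ring_hom_on B \<phi>" "\<phi> u \<noteq> 0"
  using assms by (auto simp: separated_by_homs_def)

lemma separated_by_homs_adjoin_algebraic:
  fixes B :: "'a::idom set"
  assumes B: "unital_subring B" and separated: "separated_by_homs B TYPE('b::alg_closed_field)"
    and a: "algebraic_over B a"
  shows "separated_by_homs (adjoin B a) TYPE('b)"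
  unfolding separated_by_homs_def
proof (intro ballI impI)
  interpret unital_subring B by (rule B)
  fix u assume u: "u \<in> adjoin B a" "u \<noteq> 0"
  obtain s where s: "s \<in> adjoin B a" "s * u \<in> B" "s * u \<noteq> 0"
    using algebraic_adjoin_multiple_in_base[OF B a u] .
  obtain P where P: "min_poly_over B a P" using algebraic_over_imp_min_poly[OF a] .
  have lead: "lead_coeff P \<in> B" "lead_coeff P \<noteq> 0"
    using coeff_mem[OF min_poly_over_mem[OF P]] min_poly_over_nonzero[OF P] by auto
  obtain \<phi> :: "'a \<Rightarrow> 'b" where \<phi>: "ring_hom_on B \<phi>" "\<phi> (lead_coeff P * (s * u)) \<noteq> 0"
    using separated_by_homsE[OF separated, of "lead_coeff P * (s * u)"] lead s(2,3) by auto
  then have "\<phi> (lead_coeff P) \<noteq> 0" "\<phi> (s * u) \<noteq> 0"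
    using lead(1) s(2) by (auto simp: ring_hom_on.hom_mult)
  then obtain \<psi> where \<psi>: "ring_hom_on (adjoin B a) \<psi>" "\<And>x. x \<in> B \<Longrightarrow> \<psi> x = \<phi> x"
    using hom_to_alg_closed_extends[OF \<phi>(1) P] by blast
  have "\<psi> s * \<psi> u \<noteq> 0"
    using ring_hom_on.hom_mult[OF \<psi>(1) s(1) u(1)] \<psi>(2)[OF s(2)] \<open>\<phi> (s * u) \<noteq> 0\<close> by simp
  with \<psi>(1) show "\<exists>\<psi>::'a \<Rightarrow> 'b. ring_hom_on (adjoin B a) \<psi> \<and> \<psi> u \<noteq> 0" by auto
qed

lemma separated_by_homs_adjoin_transcendental:
  assumes B: "unital_subring B" and separated: "separated_by_homs B TYPE('b::{idom, ring_char_0})"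
    and a: "\<not> algebraic_over B a"
  shows "separated_by_homs (adjoin B a) TYPE('b)"
  unfolding separated_by_homs_def
proof (intro ballI impI)
  interpret unital_subring B by (rule B)
  fix u assume u: "u \<in> adjoin B a" "u \<noteq> 0"
  obtain p where p: "p \<in> poly_over B" "u = poly p a" using u(1) by (rule adjoinE)
  then have "lead_coeff p \<in> B" "lead_coeff p \<noteq> 0" using u(2) coeff_mem by auto
  then obtain \<phi> :: "'a \<Rightarrow> 'b" where \<phi>: "ring_hom_on B \<phi>" "\<phi> (lead_coeff p) \<noteq> 0"
    by (rule separated_by_homsE[OF separated])
  interpret \<phi>: ring_hom_on B \<phi> by (rule \<phi>(1))
  have "coeff (map_poly \<phi> p) (degree p) \<noteq> 0" using \<phi>(2) by (simp add: coeff_map_poly)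
  then have "map_poly \<phi> p \<noteq> 0" by auto
  then obtain c where c: "poly (map_poly \<phi> p) c \<noteq> 0" using poly_all_0_iff_0 by blast
  have "poly (map_poly \<phi> q) c = 0" if "q \<in> poly_over B" "poly q a = 0" for q
    using a that by (cases "q = 0") (auto simp: algebraic_over_def)
  then obtain \<psi> where \<psi>: "ring_hom_on (adjoin B a) \<psi>" "\<And>x. x \<in> B \<Longrightarrow> \<psi> x = \<phi> x" "\<psi> a = c"
    using \<phi>.extends_to_adjoin by metis
  have "\<psi> u = poly (map_poly \<psi> p) (\<psi> a)"
    using ring_hom_on.hom_poly[OF \<psi>(1)] p mem_adjoin poly_over_mono[OF subset_adjoin] by blast
  also have "map_poly \<psi> p = map_poly \<phi> p"
    using \<psi>(2) coeff_mem[OF p(1)] ring_hom_on.hom_zero[OF \<psi>(1)]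
    by (intro poly_eqI) (simp add: coeff_map_poly)
  finally have "\<psi> u \<noteq> 0" using c \<psi>(3) by simp
  with \<psi>(1) show "\<exists>\<psi>::'a \<Rightarrow> 'b. ring_hom_on (adjoin B a) \<psi> \<and> \<psi> u \<noteq> 0" by blast
qed

lemma separated_by_homs_finite_extension:
  fixes B :: "'a::idom set"
  assumes "finite A" "unital_subring B"
    and "separated_by_homs B TYPE('b::{alg_closed_field, ring_char_0})"
  obtains C where "unital_subring C" "B \<union> A \<subseteq> C" "separated_by_homs C TYPE('b)"
proof -
  have "\<exists>C. unital_subring C \<and> B \<union> A \<subseteq> C \<and> separated_by_homs C TYPE('b)"
    using \<open>finite A\<close>
  proof induction
    case empty
    then show ?case using assms(2,3) by auto
  next
    case (insert a A)
    then obtain C where C: "unital_subring C" "B \<union> A \<subseteq> C" "separated_by_homs C TYPE('b)" by blast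
    interpret unital_subring C by (rule C(1))
    have "separated_by_homs (adjoin C a) TYPE('b)"
      using separated_by_homs_adjoin_algebraic[OF C(1,3)]
        separated_by_homs_adjoin_transcendental[OF C(1,3)] by blast
    then show ?case
      using unital_subring_adjoin subset_adjoin[of a] mem_adjoin[of a] C(2)
      by (intro exI[of _ "adjoin C a"]) auto
  qed
  then show ?thesis using that by blast
qed

definition Rats_hom :: "'a::field_char_0 \<Rightarrow> 'b::field_char_0" where
  "Rats_hom x = of_rat (the_inv of_rat x)"

lemma Rats_hom_of_rat [simp]: "Rats_hom (of_rat q) = of_rat q"
  by (simp add: Rats_hom_def the_inv_f_f inj_def)

lemma ring_hom_on_Rats_hom: "ring_hom_on \<rat> Rats_hom"
proof -
  interpret unital_subfield \<rat> by (rule unital_subfield_Rats)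
  show ?thesis
  proof
    show "Rats_hom 1 = 1" using Rats_hom_of_rat[of 1] by simp
  qed (auto elim!: Rats_cases simp: of_rat_add of_rat_mult simp flip: of_rat_add of_rat_mult)
qed

lemma finite_set_hom_to_alg_closed:
  fixes A :: "'a::field_char_0 set"
  assumes "finite A"
  obtains B and \<phi> :: "'a \<Rightarrow> 'b::{alg_closed_field, field_char_0}"
  where "A \<subseteq> B" "ring_hom_on B \<phi>"
proof -
  interpret unital_subfield "\<rat> :: 'a set" by (rule unital_subfield_Rats)
  have "separated_by_homs (\<rat> :: 'a set) TYPE('b)"
    using ring_hom_on_Rats_hom ring_hom_on_subfield_nonzero[OF unital_subfield_Rats]
    unfolding separated_by_homs_def by blast
  then obtain B where B: "unital_subring B" "\<rat> \<union> A \<subseteq> B" "separated_by_homs B TYPE('b)"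
    using separated_by_homs_finite_extension[OF assms unital_subring_axioms] by blast
  then obtain \<phi> :: "'a \<Rightarrow> 'b" where "ring_hom_on B \<phi>"
    using separated_by_homsE[OF B(3) unital_subring.one_mem[OF B(1)] one_neq_zero] by blast
  with B(2) that show ?thesis by blast
qed

section \<open>Subfields of an algebraic closure\<close>

lemma unital_subfield_adjoin_algebraic:
  assumes F: "unital_subfield F" and a: "algebraic_over F a"
  shows "unital_subfield (adjoin F a)"
proof -
  interpret unital_subfield F by (rule F)
  interpret adjoin: unital_subring "adjoin F a" by (rule unital_subring_adjoin)
  show ?thesis
  proof
    fix u assume u: "u \<in> adjoin F a"
    show "inverse u \<in> adjoin F a"
    proof (cases "u = 0")
      case False
      obtain s where s: "s \<in> adjoin F a" "s * u \<in> F" "s * u \<noteq> 0"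
        using algebraic_adjoin_multiple_in_base[OF unital_subring_axioms a u False] .
      then have "inverse (s * u) \<in> adjoin F a" using inverse_mem subset_adjoin by blast
      with s(1) have "s * inverse (s * u) \<in> adjoin F a" by (rule adjoin.mult_mem)
      also have "s * inverse (s * u) = inverse u" using s(3) by simp
      finally show ?thesis .
    qed (use u in simp)
  qed
qed

lemma unique_root_mem_subfield:
  fixes F :: "'a::{alg_closed_field, field_char_0} set"
  assumes F: "unital_subfield F" and p: "p \<in> poly_over F" "degree p > 0"
    and unique: "\<And>x. poly p x = 0 \<Longrightarrow> x = y"
  shows "y \<in> F"
proof -
  interpret unital_subfield F by (rule F)
  obtain n where n: "degree p = Suc n" using p(2) gr0_conv_Suc by blast
  then have "p \<noteq> 0" by auto
  then obtain R where R: "size R = Suc n" "p = smult (lead_coeff p) (\<Prod>x\<in>#R. [:- x, 1:])"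
    using alg_closed_imp_factorization n by metis
  have "poly p x = 0" if "x \<in># R" for x
    by (subst R(2)) (use that in \<open>auto simp: poly_prod_mset\<close>)
  then have "R = replicate_mset (Suc n) y"
    using unique R(1) set_mset_subset_singletonD[of R y] by auto
  then have "p = smult (lead_coeff p) ([:- y, 1:] ^ Suc n)"
    using R(2) by (simp add: prod_mset_replicate_mset)
  \<comment> \<open>In characteristic 0 the coefficient of degree \<open>n\<close> determines \<open>y\<close>.\<close>
  then have "coeff p n = lead_coeff p * coeff ([:- y, 1:] ^ Suc n) n" by (metis coeff_smult)
  also have "coeff ([:- y, 1:] ^ Suc n) n = - (of_nat (Suc n) * y)"
    by (subst coeff_linear_poly_power) simp_all
  finally have "y = - coeff p n / (lead_coeff p * of_nat (Suc n))"
    using \<open>p \<noteq> 0\<close> by (simp del: of_nat_Suc)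
  then show ?thesis using coeff_mem[OF p(1)] by (simp add: divide_inverse del: of_nat_Suc)
qed

lemma unique_common_root_mem_subfield:
  fixes F :: "'a::{alg_closed_field, field_char_0} set"
  assumes F: "unital_subfield F" and p: "p \<in> poly_over F" "poly p y = 0" "p \<noteq> 0"
    and q: "q \<in> poly_over F" "poly q y = 0"
    and unique: "\<And>x. poly p x = 0 \<Longrightarrow> poly q x = 0 \<Longrightarrow> x = y"
  shows "y \<in> F"
proof -
  interpret unital_subfield F by (rule F)
  have "algebraic_over F y" using p by (auto simp: algebraic_over_def)
  then obtain P where P: "min_poly_over F y P" by (rule algebraic_over_imp_min_poly)
  have "P dvd p" "P dvd q" using min_poly_over_dvd[OF P] p q by auto
  then have "x = y" if "poly P x = 0" for x using that by (auto intro!: unique elim!: dvdE)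
  then show ?thesis
    using unique_root_mem_subfield[OF F min_poly_over_mem[OF P] min_poly_over_degree_pos[OF P]]
    by blast
qed

lemma ex_of_nat_combination_neq:
  fixes x y :: "'a::field_char_0"
  assumes "finite S" "finite T"
  shows "\<exists>n::nat. \<forall>x'\<in>S. \<forall>y'\<in>T. y' \<noteq> y \<longrightarrow> x' + of_nat n * y' \<noteq> x + of_nat n * y"
proof -
  define bad where "bad = (\<lambda>(x', y'). (x' - x) / (y - y')) ` (S \<times> T)"
  have "finite bad" using assms by (simp add: bad_def)
  moreover have "infinite (range (of_nat :: nat \<Rightarrow> 'a))"
    by (simp add: range_inj_infinite inj_of_nat)
  ultimately obtain n where n: "of_nat n \<notin> bad" by (metis finite_subset image_subsetI)
  have "x' + of_nat n * y' \<noteq> x + of_nat n * y" if "x' \<in> S" "y' \<in> T" "y' \<noteq> y" for x' y'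
  proof
    assume "x' + of_nat n * y' = x + of_nat n * y"
    then have "of_nat n = (x' - x) / (y - y')" using that(3) by (simp add: field_simps)
    then show False using n that(1,2) by (force simp: bad_def)
  qed
  then show ?thesis by blast
qed

locale alg_closure_of = unital_subfield F for F :: "'a::{alg_closed_field, field_char_0} set" +
  assumes algebraic: "algebraic_over F y"
begin

lemma alg_closure_of_adjoin: "alg_closure_of (adjoin F a)"
proof -
  interpret adjoin: unital_subfield "adjoin F a"
    using unital_subfield_axioms algebraic by (rule unital_subfield_adjoin_algebraic)
  show ?thesis
    by unfold_locales (rule algebraic_over_mono[OF algebraic subset_adjoin])
qed

lemma primitive_element_pair: "\<exists>\<theta>. x \<in> adjoin F \<theta> \<and> y \<in> adjoin F \<theta>"
proof -
  obtain p where p: "p \<in> poly_over F" "p \<noteq> 0" "poly p x = 0"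
    using algebraic by (auto simp: algebraic_over_def)
  obtain q where q: "q \<in> poly_over F" "q \<noteq> 0" "poly q y = 0"
    using algebraic by (auto simp: algebraic_over_def)
  obtain n where n: "\<And>x' y'. poly p x' = 0 \<Longrightarrow> poly q y' = 0 \<Longrightarrow> y' \<noteq> y \<Longrightarrow>
      x' + of_nat n * y' \<noteq> x + of_nat n * y"
    using ex_of_nat_combination_neq[of "{x. poly p x = 0}" "{y. poly q y = 0}" y x]
      p(2) q(2) poly_roots_finite by blast
  define \<theta> where "\<theta> = x + of_nat n * y"
  interpret S: alg_closure_of "adjoin F \<theta>" by (rule alg_closure_of_adjoin)
  have \<theta>: "\<theta> \<in> adjoin F \<theta>" by (rule mem_adjoin)
  have pq: "p \<in> poly_over (adjoin F \<theta>)" "q \<in> poly_over (adjoin F \<theta>)"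
    using p(1) q(1) poly_over_mono[OF subset_adjoin] by blast+
  have "y \<in> adjoin F \<theta>"
  proof (rule unique_common_root_mem_subfield[OF S.unital_subfield_axioms pq(2) q(3,2)])
    show "p \<circ>\<^sub>p [:\<theta>, - of_nat n:] \<in> poly_over (adjoin F \<theta>)"
      using pq(1) \<theta> by (intro S.pcompose_mem_poly_over) auto
    show "poly (p \<circ>\<^sub>p [:\<theta>, - of_nat n:]) y = 0"
      using p(3) by (simp add: poly_pcompose \<theta>_def)
    fix y' assume "poly q y' = 0" "poly (p \<circ>\<^sub>p [:\<theta>, - of_nat n:]) y' = 0"
    then show "y' = y"
      using n[of "\<theta> - of_nat n * y'" y'] by (auto simp: poly_pcompose \<theta>_def mult.commute)
  qed
  moreover from this have "\<theta> - of_nat n * y \<in> adjoin F \<theta>" using \<theta> by simp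
  ultimately show ?thesis by (auto simp: \<theta>_def)
qed

theorem primitive_element:
  assumes "finite Y"
  obtains \<theta> where "Y \<subseteq> adjoin F \<theta>"
proof -
  have "\<exists>\<theta>. Y \<subseteq> adjoin F \<theta>" using assms
  proof induction
    case (insert y Y)
    then obtain \<eta> where \<eta>: "Y \<subseteq> adjoin F \<eta>" by blast
    obtain \<theta> where \<theta>: "\<eta> \<in> adjoin F \<theta>" "y \<in> adjoin F \<theta>" using primitive_element_pair by blast
    interpret S: alg_closure_of "adjoin F \<theta>" by (rule alg_closure_of_adjoin)
    have "adjoin F \<eta> \<subseteq> adjoin F \<theta>" using subset_adjoin \<theta>(1) by (rule S.adjoin_subset)
    then show ?case using \<eta> \<theta>(2) by blast
  qed simp
  then show ?thesis using that by blast
qed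

lemma conjugation_exists:
  assumes "y \<notin> F"
  obtains \<sigma> :: "'a \<Rightarrow> 'a" where "ring_hom_on (adjoin F y) \<sigma>" "\<sigma> y \<noteq> y"
proof -
  obtain P where P: "min_poly_over F y P" using algebraic_over_imp_min_poly[OF algebraic] .
  obtain y' where y': "poly P y' = 0" "y' \<noteq> y"
    using unique_root_mem_subfield[OF unital_subfield_axioms min_poly_over_mem[OF P]
        min_poly_over_degree_pos[OF P]] assms by blast
  have id: "ring_hom_on F id" by unfold_locales auto
  obtain \<sigma> where "ring_hom_on (adjoin F y) \<sigma>" "\<sigma> y = y'"
    using hom_extends_to_root[OF id P, of y'] y'(1) min_poly_over_nonzero[OF P] by auto
  with that y'(2) show ?thesis by blast
qed

lemma finite_set_conjugation_exists:
  assumes "finite Y" "y \<notin> F"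
  obtains C and \<sigma> :: "'a \<Rightarrow> 'a" where "Y \<subseteq> C" "ring_hom_on C \<sigma>" "\<sigma> y \<noteq> y"
proof -
  obtain \<theta> where \<theta>: "Y \<subseteq> adjoin F \<theta>" using primitive_element[OF assms(1)] .
  obtain \<tau> where \<tau>: "ring_hom_on (adjoin F y) \<tau>" "\<tau> y \<noteq> y" using conjugation_exists[OF assms(2)] .
  interpret E: alg_closure_of "adjoin F y" by (rule alg_closure_of_adjoin)
  interpret C: alg_closure_of "adjoin (adjoin F y) \<theta>" by (rule E.alg_closure_of_adjoin)
  obtain P where P: "min_poly_over (adjoin F y) \<theta> P"
    using algebraic_over_imp_min_poly[OF E.algebraic] .
  have "\<tau> (lead_coeff P) \<noteq> 0"
    using coeff_mem[OF min_poly_over_mem[OF P]] min_poly_over_nonzero[OF P]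
    by (intro ring_hom_on_subfield_nonzero[OF E.unital_subfield_axioms \<tau>(1)]) auto
  then obtain \<sigma> where \<sigma>: "ring_hom_on (adjoin (adjoin F y) \<theta>) \<sigma>"
      "\<And>x. x \<in> adjoin F y \<Longrightarrow> \<sigma> x = \<tau> x"
    using hom_to_alg_closed_extends[OF \<tau>(1) P] by blast
  have "adjoin F \<theta> \<subseteq> adjoin (adjoin F y) \<theta>"
    using subset_trans[OF subset_adjoin E.subset_adjoin] E.mem_adjoin by (rule C.adjoin_subset)
  moreover have "\<sigma> y \<noteq> y" using \<sigma>(2)[OF mem_adjoin] \<tau>(2) by simp
  ultimately show ?thesis using \<theta> \<sigma>(1) that by blast
qed

end

section \<open>Fields in which all rational polynomials have roots\<close>

definition has_rat_poly_roots :: "'a::field_char_0 itself \<Rightarrow> bool" where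
  "has_rat_poly_roots _ \<longleftrightarrow> (\<forall>p::rat poly. degree p > 0 \<longrightarrow> (\<exists>x::'a. poly (map_poly of_rat p) x = 0))"

lemma to_ac_rat_eq_of_rat: "to_ac (q::rat) = of_rat q"
proof -
  obtain a b where "q = of_int a / of_int b"
    by (metis Fract_of_int_quotient Rat_cases)
  then show ?thesis by (simp add: of_rat_divide)
qed

interpretation Rats_alg_closure: alg_closure_of "\<rat> :: rat alg_closure set"
proof -
  interpret unital_subfield "\<rat> :: rat alg_closure set" by (rule unital_subfield_Rats)
  show "alg_closure_of (\<rat> :: rat alg_closure set)"
  proof
    fix y :: "rat alg_closure"
    obtain p :: "rat poly" where p: "p \<noteq> 0" "poly (map_poly to_ac p) y = 0"
      using alg_closure_algebraic .
    then show "algebraic_over \<rat> y"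
      unfolding algebraic_over_def
      by (intro bexI[of _ "map_poly to_ac p"])
        (auto simp: map_poly_eq_0_iff poly_over_def coeff_map_poly to_ac_rat_eq_of_rat)
  qed
qed

lemma poly_over_RatsE:
  assumes "P \<in> poly_over (\<rat> :: 'a::field_char_0 set)"
  obtains p where "P = map_poly of_rat p"
proof
  show "P = map_poly of_rat (map_poly Rats_hom P)"
  proof (rule poly_eqI)
    interpret ring_hom_on "\<rat> :: 'a set" "Rats_hom :: 'a \<Rightarrow> rat" by (rule ring_hom_on_Rats_hom)
    fix n
    show "coeff P n = coeff (map_poly of_rat (map_poly Rats_hom P)) n"
      using coeff_mem[OF assms, of n] by (auto simp: coeff_map_poly elim!: Rats_cases)
  qed
qed

lemma finite_algebraic_set_embeds:
  fixes Y :: "rat alg_closure set"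
  assumes roots: "has_rat_poly_roots TYPE('a::field_char_0)" and "finite Y"
  obtains C and \<psi> :: "rat alg_closure \<Rightarrow> 'a::field_char_0"
  where "Y \<subseteq> C" "ring_hom_on C \<psi>" "inj_on \<psi> C" "\<And>q. \<psi> (of_rat q) = of_rat q"
proof -
  obtain \<theta> where \<theta>: "Y \<subseteq> adjoin \<rat> \<theta>" using Rats_alg_closure.primitive_element[OF \<open>finite Y\<close>] .
  interpret C: alg_closure_of "adjoin \<rat> \<theta>" by (rule Rats_alg_closure.alg_closure_of_adjoin)
  interpret ring_hom_on "\<rat> :: rat alg_closure set" "Rats_hom :: _ \<Rightarrow> 'a"
    by (rule ring_hom_on_Rats_hom)
  obtain P where P: "min_poly_over \<rat> \<theta> P"
    using algebraic_over_imp_min_poly[OF Rats_alg_closure.algebraic] .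
  obtain p where p: "P = map_poly of_rat p" using poly_over_RatsE[OF min_poly_over_mem[OF P]] .
  have "degree p > 0" using min_poly_over_degree_pos[OF P] by (simp add: p degree_map_poly)
  then obtain c :: 'a where "poly (map_poly of_rat p) c = 0"
    using roots by (auto simp: has_rat_poly_roots_def)
  then have c: "poly (map_poly Rats_hom P) c = 0" by (simp add: p map_poly_map_poly comp_def)
  have "(Rats_hom :: _ \<Rightarrow> 'a) (lead_coeff P) \<noteq> 0"
    using \<open>degree p > 0\<close> by (auto simp: p coeff_map_poly degree_map_poly)
  then obtain \<psi> :: "rat alg_closure \<Rightarrow> 'a"
    where \<psi>: "ring_hom_on (adjoin \<rat> \<theta>) \<psi>" "\<And>x. x \<in> \<rat> \<Longrightarrow> \<psi> x = Rats_hom x"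
    using hom_extends_to_root[OF ring_hom_on_axioms P _ c] by blast
  show ?thesis
    using \<theta> \<psi> ring_hom_on_subfield_inj_on[OF C.unital_subfield_axioms \<psi>(1)] by (intro that) auto
qed

lemma adequate_for_hom_fixes:
  assumes "adequate_for r A" "ring_hom_on B f" "A \<subseteq> B"
  shows "f r = r"
proof -
  interpret ring_hom_on B f by (rule assms(2))
  have "f (a + b) = f a + f b" "f (a * b) = f a * f b" if "a \<in> A" "b \<in> A" for a b
    using that assms(3) by (auto intro: hom_add hom_mult)
  with assms(1) show ?thesis unfolding adequate_for_def by simp
qed

lemma adequate_for_hom_image_rational:
  fixes r :: "'a::field_char_0" and \<phi> :: "'a \<Rightarrow> rat alg_closure"
  assumes roots: "has_rat_poly_roots TYPE('a)"
    and A: "adequate_for r A" and \<phi>: "ring_hom_on B \<phi>" "A \<subseteq> B"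
  shows "\<phi> r \<in> \<rat>"
proof (rule ccontr)
  assume "\<phi> r \<notin> \<rat>"
  have fin: "finite (\<phi> ` A)" and "r \<in> A" using A by (auto simp: adequate_for_def)
  obtain D \<sigma> where \<sigma>: "\<phi> ` A \<subseteq> D" "ring_hom_on D \<sigma>" "\<sigma> (\<phi> r) \<noteq> \<phi> r"
    using Rats_alg_closure.finite_set_conjugation_exists[OF fin \<open>\<phi> r \<notin> \<rat>\<close>] .
  obtain C and \<psi> :: "rat alg_closure \<Rightarrow> 'a"
    where \<psi>: "\<phi> ` A \<union> \<sigma> ` \<phi> ` A \<subseteq> C" "ring_hom_on C \<psi>" "inj_on \<psi> C"
    using finite_algebraic_set_embeds[OF roots finite_UnI[OF fin finite_imageI[OF fin]]] by metis
  have "(\<psi> \<circ> \<phi>) r = r"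
    using \<phi>(2) \<psi>(1) by (intro adequate_for_hom_fixes[OF A ring_hom_on_comp[OF \<phi>(1) \<psi>(2)]]) auto
  moreover have "(\<psi> \<circ> (\<sigma> \<circ> \<phi>)) r = r"
    using \<phi>(2) \<sigma>(1) \<psi>(1)
    by (intro adequate_for_hom_fixes[OF A
          ring_hom_on_comp[OF ring_hom_on_comp[OF \<phi>(1) \<sigma>(2)] \<psi>(2)]])
      (auto simp: image_subset_iff)
  ultimately have "\<psi> (\<sigma> (\<phi> r)) = \<psi> (\<phi> r)" by simp
  then have "\<sigma> (\<phi> r) = \<phi> r" using \<psi>(1,3) \<open>r \<in> A\<close> by (auto simp: image_subset_iff dest: inj_onD)
  with \<sigma>(3) show False ..
qed

lemma Ktilde_subset_Rats:
  assumes roots: "has_rat_poly_roots TYPE('a::field_char_0)"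
  shows "(Ktilde :: 'a set) \<subseteq> \<rat>"
proof
  fix r :: 'a assume "r \<in> Ktilde"
  then obtain A where A: "adequate_for r A" by (auto simp: Ktilde_def)
  then have "finite A" by (simp add: adequate_for_def)
  then obtain B and \<phi> :: "'a \<Rightarrow> rat alg_closure" where \<phi>: "A \<subseteq> B" "ring_hom_on B \<phi>"
    by (rule finite_set_hom_to_alg_closed)
  obtain C and \<psi> :: "rat alg_closure \<Rightarrow> 'a"
    where \<psi>: "\<phi> ` A \<subseteq> C" "ring_hom_on C \<psi>" "\<And>q. \<psi> (of_rat q) = of_rat q"
    using finite_algebraic_set_embeds[OF roots finite_imageI[OF \<open>finite A\<close>]] by metis
  have "(\<psi> \<circ> \<phi>) r = r"
    using \<phi>(1) \<psi>(1) by (intro adequate_for_hom_fixes[OF A ring_hom_on_comp[OF \<phi>(2) \<psi>(2)]]) auto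
  moreover have "\<phi> r \<in> \<rat>" using roots A \<phi>(2,1) by (rule adequate_for_hom_image_rational)
  ultimately show "r \<in> \<rat>" using \<psi>(3) by (auto elim!: Rats_cases)
qed

section \<open>Merging a system into one equation\<close>

lemma homogenization_eq_0_iff:
  fixes p :: "'a::field poly"
  assumes "degree p > 0" and no_root: "\<And>x. poly p x \<noteq> 0"
  shows "(\<Sum>i\<le>degree p. coeff p i * x ^ i * y ^ (degree p - i)) = 0 \<longleftrightarrow> x = 0 \<and> y = 0"
    (is "?form = 0 \<longleftrightarrow> _")
proof (cases "y = 0")
  case True
  have "?form = (\<Sum>i\<in>{degree p}. coeff p i * x ^ i * y ^ (degree p - i))"
    using True by (intro sum.mono_neutral_right) auto
  also have "\<dots> = lead_coeff p * x ^ degree p" by simp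
  finally show ?thesis using True \<open>degree p > 0\<close> by auto
next
  case False
  have "?form = y ^ degree p * poly p (x / y)"
    using False unfolding poly_altdef sum_distrib_left
    by (intro sum.cong) (auto simp: power_divide power_diff)
  then show ?thesis using False no_root by simp
qed

fun qpow :: "qpoly \<Rightarrow> nat \<Rightarrow> qpoly" where
  "qpow s 0 = QConst 1"
| "qpow s (Suc n) = QMul s (qpow s n)"

lemma qeval_qpow [simp]: "qeval v (qpow s n) = qeval v s ^ n"
  by (induction n) auto

lemma qvars_qpow: "qvars (qpow s n) \<subseteq> qvars s"
  by (induction n) auto

fun qform :: "(nat \<Rightarrow> rat) \<Rightarrow> qpoly \<Rightarrow> qpoly \<Rightarrow> nat \<Rightarrow> qpoly" where
  "qform c s t 0 = QConst (c 0)"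
| "qform c s t (Suc n) =
     QAdd (QMul t (qform c s t n)) (QMul (QConst (c (Suc n))) (qpow s (Suc n)))"

lemma qeval_qform:
  "qeval v (qform c s t n) = (\<Sum>i\<le>n. of_rat (c i) * qeval v s ^ i * qeval v t ^ (n - i))"
proof (induction n)
  case (Suc n)
  have "qeval v t * (\<Sum>i\<le>n. of_rat (c i) * qeval v s ^ i * qeval v t ^ (n - i)) =
    (\<Sum>i\<le>n. of_rat (c i) * qeval v s ^ i * qeval v t ^ (Suc n - i))"
    unfolding sum_distrib_left by (intro sum.cong) (auto simp: Suc_diff_le mult_ac)
  then show ?case using Suc by simp
qed simp

lemma qvars_qform: "qvars (qform c s t n) \<subseteq> qvars s \<union> qvars t"
  by (induction n) (use qvars_qpow in auto)

lemma qeval_qform_eq_0_iff: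
  fixes v :: "nat \<Rightarrow> 'a::field_char_0"
  assumes "degree p > 0" and "\<And>x::'a. poly (map_poly of_rat p) x \<noteq> 0"
  shows "qeval v (qform (coeff p) s t (degree p)) = 0 \<longleftrightarrow> qeval v s = 0 \<and> qeval v t = 0"
  using homogenization_eq_0_iff[of "map_poly of_rat p" "qeval v s" "qeval v t"] assms
  by (simp add: qeval_qform degree_map_poly coeff_map_poly)

lemma finite_system_single_equation:
  assumes no_roots: "\<not> has_rat_poly_roots TYPE('a::field_char_0)" and "finite E"
  obtains T where "qvars T \<subseteq> \<Union> (qvars ` E)"
    "\<And>v :: nat \<Rightarrow> 'a. qeval v T = 0 \<longleftrightarrow> (\<forall>e\<in>E. qeval v e = 0)"
proof -
  obtain p :: "rat poly" where p: "degree p > 0" "\<And>x::'a. poly (map_poly of_rat p) x \<noteq> 0"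
    using no_roots by (auto simp: has_rat_poly_roots_def)
  have "\<exists>T. qvars T \<subseteq> \<Union> (qvars ` E) \<and> (\<forall>v :: nat \<Rightarrow> 'a. qeval v T = 0 \<longleftrightarrow> (\<forall>e\<in>E. qeval v e = 0))"
    using \<open>finite E\<close>
  proof induction
    case empty
    then show ?case by (intro exI[of _ "QConst 0"]) simp
  next
    case (insert e E)
    then obtain T where T: "qvars T \<subseteq> \<Union> (qvars ` E)"
      "\<And>v :: nat \<Rightarrow> 'a. qeval v T = 0 \<longleftrightarrow> (\<forall>e\<in>E. qeval v e = 0)" by blast
    show ?case
      using T(1) qvars_qform[of "coeff p" e T "degree p"]
      by (intro exI[of _ "qform (coeff p) e T (degree p)"])
        (auto simp: qeval_qform_eq_0_iff[OF p] T(2))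
  qed
  then show ?thesis using that by blast
qed

section \<open>Definability by a single equation\<close>

definition single_equation_definable :: "'a::field_char_0 \<Rightarrow> bool" where
  "single_equation_definable r \<longleftrightarrow> (\<exists>m\<ge>1. \<exists>T. qvars T \<subseteq> {0..m} \<and>
     (\<forall>x. x = r \<longleftrightarrow> (\<exists>xs. qeval (xs(0 := x)) T = 0)))"

definition qdiff :: "qpoly \<Rightarrow> qpoly \<Rightarrow> qpoly" where
  "qdiff s t = QAdd s (QMul (QConst (-1)) t)"

lemma qeval_qdiff [simp]: "qeval v (qdiff s t) = qeval v s - qeval v t"
  by (simp add: qdiff_def of_rat_minus)

lemma qvars_qdiff [simp]: "qvars (qdiff s t) = qvars s \<union> qvars t"
  by (simp add: qdiff_def)

lemma Rats_single_equation_definable: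
  assumes "r \<in> \<rat>"
  shows "single_equation_definable r"
proof -
  obtain q where "r = of_rat q" using assms by (rule Rats_cases)
  then show ?thesis
    unfolding single_equation_definable_def
    by (intro exI[of _ 1] conjI exI[of _ "qdiff (QVar 0) (QConst q)"]) auto
qed

definition adequacy_equations :: "('a::field \<Rightarrow> nat) \<Rightarrow> 'a set \<Rightarrow> qpoly set" where
  "adequacy_equations \<iota> A =
     (\<lambda>a. qdiff (QVar (\<iota> a)) (QConst 1)) ` (A \<inter> {1})
     \<union> (\<lambda>(a, b). qdiff (QVar (\<iota> (a + b))) (QAdd (QVar (\<iota> a)) (QVar (\<iota> b)))) `
         {(a, b) \<in> A \<times> A. a + b \<in> A}
     \<union> (\<lambda>(a, b). qdiff (QVar (\<iota> (a * b))) (QMul (QVar (\<iota> a)) (QVar (\<iota> b)))) `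
         {(a, b) \<in> A \<times> A. a * b \<in> A}"

lemma finite_adequacy_equations: "finite A \<Longrightarrow> finite (adequacy_equations \<iota> A)"
  unfolding adequacy_equations_def
  by (intro finite_UnI finite_imageI) (auto intro: finite_subset[of _ "A \<times> A"])

lemma qvars_adequacy_equations: "\<Union> (qvars ` adequacy_equations \<iota> A) \<subseteq> \<iota> ` A"
  by (auto simp: adequacy_equations_def)

lemma adequacy_equations_iff:
  "(\<forall>e\<in>adequacy_equations \<iota> A. qeval v e = 0) \<longleftrightarrow>
     (1 \<in> A \<longrightarrow> v (\<iota> 1) = 1) \<and>
     (\<forall>a\<in>A. \<forall>b\<in>A. a + b \<in> A \<longrightarrow> v (\<iota> (a + b)) = v (\<iota> a) + v (\<iota> b)) \<and>
     (\<forall>a\<in>A. \<forall>b\<in>A. a * b \<in> A \<longrightarrow> v (\<iota> (a * b)) = v (\<iota> a) * v (\<iota> b))"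
  unfolding adequacy_equations_def ball_Un by auto

lemma adequacy_equations_unique_solution:
  assumes "adequate_for r A" "\<forall>e\<in>adequacy_equations \<iota> A. qeval v e = 0"
  shows "v (\<iota> r) = r"
  using assms unfolding adequate_for_def adequacy_equations_iff
  by (elim conjE allE[of _ "v \<circ> \<iota>"]) simp

lemma finite_enumeration_from:
  assumes "finite A" "r \<in> A"
  obtains \<iota> :: "'a \<Rightarrow> nat" where "inj_on \<iota> A" "\<iota> r = 0" "\<iota> ` A \<subseteq> {0..card A}"
proof -
  obtain h where h: "bij_betw h (A - {r}) {0..<card (A - {r})}"
    using ex_bij_betw_finite_nat[of "A - {r}"] assms(1) by auto
  define \<iota> where "\<iota> = (\<lambda>a. Suc (h a))(r := 0)"
  have "inj_on \<iota> A" using h by (auto simp: inj_on_def bij_betw_def \<iota>_def)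
  moreover have "Suc (h a) \<le> card A" if "a \<in> A - {r}" for a
    using bspec[OF bij_betwE[OF h] that] card_Diff1_less[OF assms] unfolding atLeastLessThan_iff
    by linarith
  then have "\<iota> ` A \<subseteq> {0..card A}" by (auto simp: \<iota>_def)
  ultimately show ?thesis using that[of \<iota>] by (simp add: \<iota>_def)
qed

lemma Ktilde_single_equation_definable:
  fixes r :: "'a::field_char_0"
  assumes no_roots: "\<not> has_rat_poly_roots TYPE('a)" and "r \<in> Ktilde"
  shows "single_equation_definable r"
proof -
  obtain A where A: "adequate_for r A" using \<open>r \<in> Ktilde\<close> by (auto simp: Ktilde_def)
  then have fin: "finite A" and "r \<in> A" by (auto simp: adequate_for_def)
  then obtain \<iota> :: "'a \<Rightarrow> nat" where \<iota>: "inj_on \<iota> A" "\<iota> r = 0" "\<iota> ` A \<subseteq> {0..card A}"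
    by (rule finite_enumeration_from)
  obtain T where T: "qvars T \<subseteq> \<Union> (qvars ` adequacy_equations \<iota> A)"
    "\<And>v :: nat \<Rightarrow> 'a. qeval v T = 0 \<longleftrightarrow> (\<forall>e\<in>adequacy_equations \<iota> A. qeval v e = 0)"
    using finite_system_single_equation[OF no_roots finite_adequacy_equations[OF fin]] by metis
  have unique: "v 0 = r" if "qeval v T = 0" for v :: "nat \<Rightarrow> 'a"
    using adequacy_equations_unique_solution[OF A, of \<iota> v] that \<iota>(2) by (simp add: T(2))
  have solution: "qeval (inv_into A \<iota>) T = 0"
    using \<iota>(1) by (simp add: T(2) adequacy_equations_iff)
  have "x = r \<longleftrightarrow> (\<exists>xs::nat \<Rightarrow> 'a. qeval (xs(0 := x)) T = 0)" for x
  proof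
    assume "x = r"
    then have "(inv_into A \<iota>)(0 := x) = inv_into A \<iota>"
      using unique[OF solution] by (simp add: fun_upd_idem)
    with solution show "\<exists>xs. qeval (xs(0 := x)) T = 0" by metis
  next
    assume "\<exists>xs. qeval (xs(0 := x)) T = 0"
    then show "x = r" using unique by force
  qed
  moreover have "card A \<ge> 1" using fin \<open>r \<in> A\<close> card_gt_0_iff[of A] by auto
  moreover have "qvars T \<subseteq> {0..card A}" using T(1) qvars_adequacy_equations \<iota>(3) by blast
  ultimately show ?thesis unfolding single_equation_definable_def by blast
qed

theorem theorem5:
  fixes r :: "'a::field_char_0"
  assumes "r \<in> Ktilde"
  shows "\<exists>m::nat. m \<ge> 1 \<and> (\<exists>T::qpoly. qvars T \<subseteq> {0..m} \<and>
           (\<forall>x::'a. x = r \<longleftrightarrow>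
              (\<exists>xs::nat \<Rightarrow> 'a. qeval (xs(0 := x)) T = 0)))"
proof -
  have "single_equation_definable r"
  proof (cases "has_rat_poly_roots TYPE('a)")
    case True
    then have "r \<in> \<rat>" using Ktilde_subset_Rats assms by blast
    then show ?thesis by (rule Rats_single_equation_definable)
  next
    case False
    then show ?thesis using assms by (rule Ktilde_single_equation_definable)
  qed
  then show ?thesis unfolding single_equation_definable_def .
qed

end
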